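(* Let $X$ be a quasi-Banach space that is not locally convex, with modulus of concavity $\kappa$. For every $0<\eta<1$ there exist a Lipschitz curve $F\colon\mathbb{R}\to X$ and sequences $(r_j)_{j=1}^\infty$ and $(\varepsilon_j)_{j=1}^\infty$ of positive numbers decreasing to zero such that $$\sup_{t\in B_{\mathbb{R}}(s,r_j)}\frac{\|F(t)-F(s)\|_X}{r_j}\le\eta$$ and $$\sup_{t\in B_{\mathbb{R}}(s,\varepsilon_j)}\frac{\|F(t)-F(s)\|_X}{\varepsilon_j}\ge\frac{1-\eta}{2\kappa^3}$$ for every $j\in\mathbb{N}$ and every $s\in\mathbb{R}$.
   Context: A quasi-norm on a real or complex vector space $X$ is a map $\|\cdot\|_X\colon X\to[0,\infty)$ with $\|x\|_X>0$ for $x\neq 0$, $\|\alpha x\|_X=|\alpha|\,\|x\|_X$ for all scalars $\alpha$, and $\|x+y\|_X\le\kappa(\|x\|_X+\|y\|_X)$ for some constant $\kappa\ge1$ and all $x,y\in X$; the smallest such $\kappa$ is the modulus of concavity. A quasi-normed space is a quasi-Banach space if it is complete for the induced metrizable linear topology. $X$ is locally convex if the origin has a neighbourhood basis of absolutely convex sets (equivalently, there is a norm on $X$ equivalent to $\|\cdot\|_X$). $F\colon\mathbb{R}\to X$ is Lipschitz if there is $L<\infty$ with $\|F(t)-F(s)\|_X\le L|t-s|$ for all $s,t$. $B_{\mathbb{R}}(s,r)=\{t\in\mathbb{R}:|t-s|\le r\}$. *)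

theory Defs
  imports "HOL-Analysis.Analysis"
begin

text \<open>
  The scalars range over an arbitrary type of class \<open>real_normed_field\<close>. By the
  Gelfand--Mazur theorem such a field is isometrically isomorphic to the reals or to the
  complex numbers, so real and complex spaces are treated uniformly.
\<close>

definition quasi_triangle_const :: "('a::ab_group_add \<Rightarrow> real) \<Rightarrow> real \<Rightarrow> bool" where
  "quasi_triangle_const N \<kappa> \<longleftrightarrow> 1 \<le> \<kappa> \<and> (\<forall>x y. N (x + y) \<le> \<kappa> * (N x + N y))"

locale quasi_normed_space = vector_space smul
  for smul :: "'k::real_normed_field \<Rightarrow> 'a::ab_group_add \<Rightarrow> 'a" +
  fixes N :: "'a \<Rightarrow> real"
  assumes qnorm_nonneg: "0 \<le> N x"
    and qnorm_pos: "x \<noteq> 0 \<Longrightarrow> 0 < N x"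
    and qnorm_scale: "N (smul a x) = norm a * N x"
    and qnorm_quasi_triangle: "\<exists>\<kappa>. quasi_triangle_const N \<kappa>"

text \<open>The least constant exists in every quasi-normed space; see \<open>modulus_attained\<close> below.\<close>

definition modulus_of_concavity :: "('a::ab_group_add \<Rightarrow> real) \<Rightarrow> real" where
  "modulus_of_concavity N = (LEAST \<kappa>. quasi_triangle_const N \<kappa>)"

text \<open>
  A quasi-norm need not be continuous, so the sets \<open>{y. N (y - x) < e}\<close> need not be open;
  they are neighbourhoods of \<open>x\<close> nevertheless (\<open>qball_nhd\<close> below).
\<close>

definition qnorm_topology :: "('a::ab_group_add \<Rightarrow> real) \<Rightarrow> 'a topology" where
  "qnorm_topology N =
     topology (\<lambda>U. \<forall>x\<in>U. \<exists>e>0. \<forall>y. N (y - x) < e \<longrightarrow> y \<in> U)"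

text \<open>
  Completeness as a topological vector space; Cauchy sequences suffice because the topology
  is metrizable.
\<close>

locale quasi_banach_space = quasi_normed_space smul N
  for smul :: "'k::real_normed_field \<Rightarrow> 'a::ab_group_add \<Rightarrow> 'a" and N +
  assumes qnorm_complete:
    "(\<And>U. openin (qnorm_topology N) U \<Longrightarrow> 0 \<in> U \<Longrightarrow>
        \<exists>M. \<forall>m\<ge>M. \<forall>n\<ge>M. X m - X n \<in> U) \<Longrightarrow>
     \<exists>l. limitin (qnorm_topology N) X l sequentially"

definition absolutely_convex ::
    "('k::real_normed_field \<Rightarrow> 'a::ab_group_add \<Rightarrow> 'a) \<Rightarrow> 'a set \<Rightarrow> bool" where
  "absolutely_convex smul V \<longleftrightarrow>
     (\<forall>x\<in>V. \<forall>y\<in>V. \<forall>a b. norm a + norm b \<le> 1 \<longrightarrow> smul a x + smul b y \<in> V)"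

definition locally_convex ::
    "('k::real_normed_field \<Rightarrow> 'a::ab_group_add \<Rightarrow> 'a) \<Rightarrow> ('a \<Rightarrow> real) \<Rightarrow> bool" where
  "locally_convex smul N \<longleftrightarrow>
     (\<forall>U. openin (qnorm_topology N) U \<and> 0 \<in> U \<longrightarrow>
        (\<exists>V W. openin (qnorm_topology N) W \<and> 0 \<in> W \<and> W \<subseteq> V \<and> V \<subseteq> U \<and>
               absolutely_convex smul V))"

text \<open>
  For a Lipschitz curve \<open>F\<close> and \<open>r > 0\<close> the values \<open>N (F t - F s) / r\<close> with
  \<open>t \<in> cball s r\<close> are bounded above, so their supremum may be taken in the reals.
\<close>

definition lipschitz_curve :: "('a::ab_group_add \<Rightarrow> real) \<Rightarrow> (real \<Rightarrow> 'a) \<Rightarrow> bool" where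
  "lipschitz_curve N F \<longleftrightarrow> (\<exists>L. \<forall>s t. N (F t - F s) \<le> L * \<bar>t - s\<bar>)"

definition decreasing_to_zero :: "(nat \<Rightarrow> real) \<Rightarrow> bool" where
  "decreasing_to_zero r \<longleftrightarrow> (\<forall>j. 0 < r j) \<and> (\<forall>j. r (Suc j) < r j) \<and> r \<longlonglongrightarrow> 0"

lemma openin_qnorm_topology:
  "openin (qnorm_topology N) U \<longleftrightarrow> (\<forall>x\<in>U. \<exists>e>0. \<forall>y. N (y - x) < e \<longrightarrow> y \<in> U)"
proof -
  have "istopology (\<lambda>U. \<forall>x\<in>U. \<exists>e>0. \<forall>y. N (y - x) < e \<longrightarrow> y \<in> U)"
    unfolding istopology_def
  proof (intro conjI allI impI ballI)
    fix S T x
    assume S: "\<forall>x\<in>S. \<exists>e>0. \<forall>y. N (y - x) < e \<longrightarrow> y \<in> S"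
      and T: "\<forall>x\<in>T. \<exists>e>0. \<forall>y. N (y - x) < e \<longrightarrow> y \<in> T" and x: "x \<in> S \<inter> T"
    obtain d e where "d > 0" "\<forall>y. N (y - x) < d \<longrightarrow> y \<in> S"
        "e > 0" "\<forall>y. N (y - x) < e \<longrightarrow> y \<in> T"
      using S T x by blast
    then show "\<exists>e>0. \<forall>y. N (y - x) < e \<longrightarrow> y \<in> S \<inter> T"
      by (intro exI[of _ "min d e"]) auto
  next
    fix K x
    assume "\<forall>S\<in>K. \<forall>x\<in>S. \<exists>e>0. \<forall>y. N (y - x) < e \<longrightarrow> y \<in> S" and "x \<in> \<Union>K"
    then show "\<exists>e>0. \<forall>y. N (y - x) < e \<longrightarrow> y \<in> \<Union>K"
      by (meson Union_iff)
  qed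
  then show ?thesis
    by (simp add: qnorm_topology_def topology_inverse')
qed

context quasi_normed_space
begin

lemma
  shows modulus_attained: "quasi_triangle_const N (modulus_of_concavity N)"
    and modulus_least: "quasi_triangle_const N \<kappa> \<Longrightarrow> modulus_of_concavity N \<le> \<kappa>"
proof -
  let ?K = "{\<kappa>. quasi_triangle_const N \<kappa>}"
  have ne: "?K \<noteq> {}"
    using qnorm_quasi_triangle by auto
  have bdd: "bdd_below ?K"
    by (auto simp: quasi_triangle_const_def intro: bdd_belowI[of _ 1])
  have "?K = {1..} \<inter> (\<Inter>x. \<Inter>y. {\<kappa>. N (x + y) \<le> \<kappa> * (N x + N y)})"
    by (auto simp: quasi_triangle_const_def)
  moreover have "closed \<dots>"
    by (intro closed_Int closed_INT ballI closed_atLeast closed_Collect_le continuous_intros)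
  ultimately have Inf: "Inf ?K \<in> ?K"
    using closed_contains_Inf[OF ne bdd] by simp
  have lower: "Inf ?K \<le> c" if "quasi_triangle_const N c" for c
    using that bdd by (auto intro: cInf_lower)
  have eq: "modulus_of_concavity N = Inf ?K"
    unfolding modulus_of_concavity_def using Inf by (intro Least_equality lower) auto
  show "quasi_triangle_const N (modulus_of_concavity N)"
    using Inf eq by simp
  show "modulus_of_concavity N \<le> \<kappa>" if "quasi_triangle_const N \<kappa>"
    using lower[OF that] eq by simp
qed

lemma qball_nhd:
  assumes "0 < e"
  shows "\<exists>U. openin (qnorm_topology N) U \<and> x \<in> U \<and> U \<subseteq> {y. N (y - x) < e}"
proof -
  obtain \<kappa> where \<kappa>: "1 \<le> \<kappa>" "\<And>x y. N (x + y) \<le> \<kappa> * (N x + N y)"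
    using qnorm_quasi_triangle by (auto simp: quasi_triangle_const_def)
  have N0: "N 0 = 0"
    using qnorm_scale[of 0 0] by simp
  define U where "U = {y. \<exists>d>0. \<forall>z. N (z - y) < d \<longrightarrow> N (z - x) < e}"
  have "openin (qnorm_topology N) U"
    unfolding openin_qnorm_topology
  proof
    fix y assume "y \<in> U"
    then obtain d where d: "d > 0" "\<And>z. N (z - y) < d \<Longrightarrow> N (z - x) < e"
      by (auto simp: U_def)
    let ?d = "d / (2 * \<kappa>)"
    have "w \<in> U" if w: "N (w - y) < ?d" for w
    proof -
      have "N (z - x) < e" if z: "N (z - w) < ?d" for z
      proof -
        have "N (z - y) \<le> \<kappa> * (N (z - w) + N (w - y))"
          using \<kappa>(2)[of "z - w" "w - y"] by simp
        also have "\<dots> < \<kappa> * (?d + ?d)"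
          using w z \<kappa>(1) by (intro mult_strict_left_mono) auto
        also have "\<dots> = d"
          using \<kappa>(1) by simp
        finally show ?thesis
          by (rule d(2))
      qed
      moreover have "?d > 0"
        using d(1) \<kappa>(1) by simp
      ultimately show ?thesis
        unfolding U_def by blast
    qed
    moreover have "?d > 0"
      using d(1) \<kappa>(1) by simp
    ultimately show "\<exists>e>0. \<forall>z. N (z - y) < e \<longrightarrow> z \<in> U"
      by blast
  qed
  moreover have "x \<in> U"
    using assms by (auto simp: U_def)
  moreover have "U \<subseteq> {y. N (y - x) < e}"
  proof
    fix y assume "y \<in> U"
    then obtain d where "d > 0" "\<And>z. N (z - y) < d \<Longrightarrow> N (z - x) < e"
      by (auto simp: U_def)
    then show "y \<in> {y. N (y - x) < e}"
      using N0 by simp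
  qed
  ultimately show ?thesis
    by blast
qed

end

end

theory Submission
  imports Defs
begin

text \<open>
  Without local convexity, sums of vectors of total quasi-norm at most 1 are unbounded, so a
  polygon can travel far although it is slow on small scales. Cutting out an interval where the
  mean speed is nearly maximal and reflecting periodically gives a bounded 1-Lipschitz curve
  \<open>g\<close> that oscillates on scale 1 but has speed at most \<open>\<delta>\<close> on scales below some \<open>\<rho>\<close>. The curve is
  \<open>F t = (\<Sum>i. \<epsilon>\<^sub>i g\<^sub>i (t / \<epsilon>\<^sub>i))\<close> with \<open>\<delta>\<^sub>i\<close> and \<open>\<epsilon>\<^sub>i\<close> decreasing fast: on scale \<open>r\<^sub>i = \<rho>\<^sub>i \<epsilon>\<^sub>i\<close> all
  terms are slow or tiny, on scale \<open>\<epsilon>\<^sub>i\<close> only the \<open>i\<close>-th one matters. The factor \<open>\<kappa>\<^sup>3\<close> comes from three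
  uses of the quasi-triangle inequality: for the oscillation of \<open>g\<^sub>i\<close>, for removing the other
  terms, and for passing to the limit of the series, where \<open>N\<close> need not be continuous.
\<close>

context quasi_normed_space
begin

section \<open>Elementary consequences of the quasi-triangle inequality\<close>

abbreviation "K \<equiv> modulus_of_concavity N"

lemma K_ge_1: "1 \<le> K"
  using modulus_attained by (simp add: quasi_triangle_const_def)

lemma qnorm_add_le: "N (x + y) \<le> K * (N x + N y)"
  using modulus_attained by (simp add: quasi_triangle_const_def)

lemma qnorm_zero [simp]: "N 0 = 0"
  using qnorm_scale[of 0 0] by simp

lemma qnorm_minus: "N (- x) = N x"
  using qnorm_scale[of "- 1" x] by simp

lemma qnorm_minus_commute: "N (x - y) = N (y - x)"
  using qnorm_minus[of "x - y"] by simp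

lemma qnorm_diff_le: "N (x - z) \<le> K * (N (x - y) + N (y - z))"
  using qnorm_add_le[of "x - y" "y - z"] by simp

text \<open>Splitting off one summand at a time costs a factor \<open>K\<close> per step, whence the
  weight \<open>K ^ Suc i\<close>. Sufficiently fast geometric decay of the terms compensates for
  it.\<close>

lemma qnorm_sum_le: "N (\<Sum>i<n. x i) \<le> (\<Sum>i<n. K ^ Suc i * N (x i))"
proof (induction n arbitrary: x)
  case (Suc n)
  have "N (\<Sum>i<Suc n. x i) \<le> K * (N (x 0) + N (\<Sum>i<n. x (Suc i)))"
    unfolding sum.lessThan_Suc_shift by (rule qnorm_add_le)
  also have "\<dots> \<le> K * (N (x 0) + (\<Sum>i<n. K ^ Suc i * N (x (Suc i))))"
    using Suc.IH[of "\<lambda>i. x (Suc i)"] K_ge_1 by (intro mult_left_mono add_left_mono) auto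
  also have "\<dots> = (\<Sum>i<Suc n. K ^ Suc i * N (x i))"
    unfolding sum.lessThan_Suc_shift by (simp add: distrib_left sum_distrib_left mult.assoc)
  finally show ?case .
qed simp

lemma qnorm_scale_of_real: "N (smul (of_real a) x) = \<bar>a\<bar> * N x"
  by (simp add: qnorm_scale)

lemma sum_list_map_smul: "sum_list (map (smul a) xs) = smul a (sum_list xs)"
  by (induction xs) (auto simp: scale_right_distrib)

lemma sum_list_qnorm_map_smul:
  "sum_list (map N (map (smul a) xs)) = norm (a::'k) * sum_list (map N xs)"
  by (induction xs) (auto simp: qnorm_scale distrib_left)

section \<open>From the failure of local convexity to slow oscillating curves\<close>

text \<open>The sums of lists of total quasi-norm at most 1 form the absolutely convex hull of the
  unit ball. If \<open>N\<close> were bounded on this hull, its multiples would be a basis of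
  absolutely convex neighbourhoods of the origin.\<close>

lemma unbounded_convex_combinations:
  assumes "\<not> locally_convex smul N" and "0 < C"
  shows "\<exists>ys. sum_list (map N ys) \<le> 1 \<and> C < N (sum_list ys)"
proof (rule ccontr)
  assume "\<not> ?thesis"
  then have bound: "N (sum_list ys) \<le> C" if "sum_list (map N ys) \<le> 1" for ys
    using that by force
  have "locally_convex smul N"
    unfolding locally_convex_def
  proof (intro allI impI, elim conjE)
    fix U assume "openin (qnorm_topology N) U" "0 \<in> U"
    then obtain e where e: "e > 0" "\<And>y. N y < e \<Longrightarrow> y \<in> U"
      by (force simp: openin_qnorm_topology)
    define d where "d = e / (2 * C)"
    have d: "d > 0" "d * C < e"
      using e \<open>0 < C\<close> by (auto simp: d_def)
    \<comment> \<open>Absolute convexity of \<open>V\<close> comes from scaling and concatenating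
      lists; lists of length one show that \<open>V\<close> contains a ball.\<close>
    define V where "V = {sum_list ys | ys. sum_list (map N ys) \<le> d}"
    have "V \<subseteq> U"
    proof
      fix v assume "v \<in> V"
      then obtain ys where ys: "v = sum_list ys" "sum_list (map N ys) \<le> d"
        by (auto simp: V_def)
      let ?zs = "map (smul (of_real (1 / d))) ys"
      have "sum_list (map N ?zs) \<le> 1"
        using ys(2) d(1) unfolding sum_list_qnorm_map_smul by (simp add: norm_divide)
      then have "N (sum_list ?zs) \<le> C"
        by (rule bound)
      then have "N v / d \<le> C"
        unfolding sum_list_map_smul using ys(1) d(1) by (simp add: qnorm_scale norm_divide)
      then have "N v < e"
        using d by (simp add: field_simps)
      then show "v \<in> U"
        by (rule e(2))
    qed
    moreover have "absolutely_convex smul V"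
      unfolding absolutely_convex_def
    proof (intro ballI allI impI)
      fix x y and a b :: 'k assume "x \<in> V" "y \<in> V" and ab: "norm a + norm b \<le> 1"
      then obtain xs ys where xs: "x = sum_list xs" "sum_list (map N xs) \<le> d"
        and ys: "y = sum_list ys" "sum_list (map N ys) \<le> d"
        by (auto simp: V_def)
      let ?zs = "map (smul a) xs @ map (smul b) ys"
      have "sum_list (map N ?zs) \<le> norm a * d + norm b * d"
        using xs(2) ys(2) sum_list_qnorm_map_smul[of a xs] sum_list_qnorm_map_smul[of b ys]
        by (auto intro!: add_mono mult_left_mono)
      also have "\<dots> \<le> d"
        using mult_right_mono[OF ab, of d] d(1) by (simp add: distrib_right)
      finally show "smul a x + smul b y \<in> V"
        unfolding V_def using xs(1) ys(1)
        by (intro CollectI exI[of _ ?zs]) (simp add: sum_list_map_smul)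
    qed
    moreover obtain W where "openin (qnorm_topology N) W" "0 \<in> W" "W \<subseteq> {y. N (y - 0) < d}"
      using qball_nhd[OF d(1), of 0] by blast
    moreover have "{y. N (y - 0) < d} \<subseteq> V"
      unfolding V_def by (force intro: exI[of _ "[_]"])
    ultimately show "\<exists>V W. openin (qnorm_topology N) W \<and> 0 \<in> W \<and> W \<subseteq> V \<and> V \<subseteq> U \<and>
        absolutely_convex smul V"
      by blast
  qed
  with assms(1) show False ..
qed

text \<open>
  The polygon with successive edges \<open>ys\<close>, parametrized by \<open>N\<close>-length. Keeping track of the speed
  on an initial interval makes sure that short intervals meet at most one vertex, so that the
  local speed is at most \<open>K\<close>, independently of the number of edges.
\<close>

lemma polygon_exists:
  "\<exists>\<gamma> \<rho> L. 0 < \<rho> \<and> (\<forall>t\<le>0. \<gamma> t = 0) \<and> (\<forall>t\<ge>sum_list (map N ys). \<gamma> t = sum_list ys) \<and>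
     (\<forall>s t. N (\<gamma> t - \<gamma> s) \<le> L * \<bar>t - s\<bar>) \<and>
     (\<forall>s t. s \<le> t \<longrightarrow> t \<le> \<rho> \<longrightarrow> N (\<gamma> t - \<gamma> s) \<le> t - s) \<and>
     (\<forall>s t. s \<le> t \<longrightarrow> t - s \<le> \<rho> \<longrightarrow> N (\<gamma> t - \<gamma> s) \<le> K * (t - s))"
proof (induction ys)
  case Nil
  show ?case
    using K_ge_1 by (intro exI[of _ "\<lambda>_. 0"] exI[of _ 1] exI[of _ 0]) auto
next
  case (Cons y ys)
  then obtain \<gamma> \<rho> L where \<rho>: "0 < \<rho>" and g0: "\<And>t. t \<le> 0 \<Longrightarrow> \<gamma> t = 0"
    and g1: "\<And>t. t \<ge> sum_list (map N ys) \<Longrightarrow> \<gamma> t = sum_list ys"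
    and gL: "\<And>s t. N (\<gamma> t - \<gamma> s) \<le> L * \<bar>t - s\<bar>"
    and gs: "\<And>s t. s \<le> t \<Longrightarrow> t \<le> \<rho> \<Longrightarrow> N (\<gamma> t - \<gamma> s) \<le> t - s"
    and gK: "\<And>s t. s \<le> t \<Longrightarrow> t - s \<le> \<rho> \<Longrightarrow> N (\<gamma> t - \<gamma> s) \<le> K * (t - s)"
    by blast
  show ?case
  proof (cases "y = 0")
    case True
    then show ?thesis
      using Cons.IH by simp
  next
    case False
    define l where "l = N y"
    have l: "l > 0"
      using False qnorm_pos by (simp add: l_def)
    have ln: "sum_list (map N ys) \<ge> 0"
      by (rule sum_list_nonneg) (auto simp: qnorm_nonneg)
    \<comment> \<open>Clamping time to the interval from 0 to \<open>l\<close> lets \<open>p\<close>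
      run along the edge \<open>y\<close> at unit speed and then rest at \<open>y\<close>. The curve
      \<open>\<phi>\<close> follows this edge first and a delayed copy of \<open>\<gamma>\<close>
      afterwards.\<close>
    define c where "c t = max 0 (min t l)" for t :: real
    define p where "p t = smul (of_real (c t / l)) y" for t
    define \<phi> where "\<phi> t = p t + \<gamma> (t - l)" for t
    have pN: "N (p t - p s) \<le> \<bar>t - s\<bar>" for s t
    proof -
      have "p t - p s = smul (of_real ((c t - c s) / l)) y"
        by (simp add: p_def scale_left_diff_distrib diff_divide_distrib)
      then have "N (p t - p s) = \<bar>c t - c s\<bar>"
        using l by (simp add: qnorm_scale_of_real abs_divide del: of_real_divide of_real_diff flip: l_def)
      also have "\<dots> \<le> \<bar>t - s\<bar>"
        by (auto simp: c_def)
      finally show ?thesis .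
    qed
    have p0: "p t = 0" if "t \<le> 0" for t
      using that by (simp add: p_def c_def)
    have p1: "p t = y" if "t \<ge> l" for t
      using that l by (simp add: p_def c_def)
    have before: "\<phi> t - \<phi> s = p t - p s" if "s \<le> l" "t \<le> l" for s t
      using that g0 by (simp add: \<phi>_def)
    have after: "\<phi> t - \<phi> s = \<gamma> (t - l) - \<gamma> (s - l)" if "s \<ge> l" "t \<ge> l" for s t
      using that p1 by (simp add: \<phi>_def)
    have loc: "N (\<phi> t - \<phi> s) \<le> K * (t - s)" if st: "s \<le> t" "t - s \<le> min \<rho> l" for s t
    proof -
      consider "t \<le> l" | "s \<ge> l" | "s < l" "l < t"
        by linarith
      then show ?thesis
      proof cases
        case 1
        then have "N (\<phi> t - \<phi> s) \<le> t - s"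
          using before[of s t] pN[of t s] st by simp
        also have "\<dots> \<le> K * (t - s)"
          using mult_right_mono[OF K_ge_1, of "t - s"] st by simp
        finally show ?thesis .
      next
        case 2
        then show ?thesis
          using after[of s t] gK[of "s - l" "t - l"] st by simp
      next
        \<comment> \<open>The interval crosses the vertex at time \<open>l\<close>. Its second half
          lies in the initial stretch of \<open>\<gamma>\<close>, where the speed is at most 1
          without a factor \<open>K\<close>, so a single quasi-triangle inequality suffices.\<close>
        case 3
        have "N (\<phi> l - \<phi> s) \<le> l - s"
          using before[of s l] pN[of l s] 3 by simp
        moreover have "N (\<phi> t - \<phi> l) \<le> t - l"
          using after[of l t] gs[of "l - l" "t - l"] 3 st by simp
        ultimately have "K * (N (\<phi> t - \<phi> l) + N (\<phi> l - \<phi> s)) \<le> K * (t - s)"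
          using K_ge_1 by (intro mult_left_mono) auto
        then show ?thesis
          using qnorm_diff_le[of "\<phi> t" "\<phi> s" "\<phi> l"] by linarith
      qed
    qed
    \<comment> \<open>This constant grows with the number of edges; only its finiteness
      matters.\<close>
    have "N (\<phi> t - \<phi> s) \<le> (K * (1 + L)) * \<bar>t - s\<bar>" for s t
    proof -
      have "N (\<phi> t - \<phi> s) \<le> K * (N (p t - p s) + N (\<gamma> (t - l) - \<gamma> (s - l)))"
        using qnorm_add_le[of "p t - p s" "\<gamma> (t - l) - \<gamma> (s - l)"]
        by (simp add: \<phi>_def algebra_simps)
      also have "\<dots> \<le> K * (\<bar>t - s\<bar> + L * \<bar>t - s\<bar>)"
        using pN[of t s] gL[of "t - l" "s - l"] K_ge_1 by (intro mult_left_mono add_mono) auto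
      finally show ?thesis
        by (simp add: algebra_simps)
    qed
    \<comment> \<open>Up to time \<open>l\<close> only the first edge is traversed, hence the cap by
      \<open>l\<close>.\<close>
    moreover have "N (\<phi> t - \<phi> s) \<le> t - s" if "s \<le> t" "t \<le> min \<rho> l" for s t
      using before[of s t] pN[of t s] that by simp
    moreover have "\<phi> t = 0" if "t \<le> 0" for t
      using that p0 g0 l by (simp add: \<phi>_def)
    moreover have "\<phi> t = sum_list (y # ys)" if "t \<ge> sum_list (map N (y # ys))" for t
      using that p1[of t] g1[of "t - l"] ln by (simp add: \<phi>_def l_def)
    ultimately show ?thesis
      using loc \<rho> l
      by (intro exI[of _ \<phi>] exI[of _ "min \<rho> l"] exI[of _ "K * (1 + L)"]) auto
  qed
qed

text \<open>
  Restricting a polygon to an interval on which its mean speed is almost the global Lipschitz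
  constant, and rescaling, yields Lipschitz constant 1 while the local speed only gets smaller.
\<close>

lemma slow_arc_exists:
  assumes "\<not> locally_convex smul N" and "0 < \<delta>" and "\<theta> < 1"
  shows "\<exists>\<gamma> \<rho>. 0 < \<rho> \<and> (\<forall>s t. N (\<gamma> t - \<gamma> s) \<le> \<bar>t - s\<bar>) \<and>
    (\<forall>s t. \<bar>t - s\<bar> \<le> \<rho> \<longrightarrow> N (\<gamma> t - \<gamma> s) \<le> \<delta> * \<bar>t - s\<bar>) \<and> \<theta> \<le> N (\<gamma> 1 - \<gamma> 0)"
proof -
  \<comment> \<open>The local speed \<open>K\<close>, divided by a normalizing factor larger than
    \<open>C\<close>, drops below \<open>\<delta>\<close>.\<close>
  define C where "C = K / \<delta>"
  have C: "C > 0"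
    using K_ge_1 assms(2) by (simp add: C_def)
  obtain ys where ys: "sum_list (map N ys) \<le> 1" "C < N (sum_list ys)"
    using unbounded_convex_combinations[OF assms(1) C] by blast
  obtain \<gamma> \<rho> L where \<rho>: "0 < \<rho>" and g0: "\<And>t. t \<le> 0 \<Longrightarrow> \<gamma> t = 0"
    and g1: "\<And>t. t \<ge> sum_list (map N ys) \<Longrightarrow> \<gamma> t = sum_list ys"
    and gL: "\<And>s t. N (\<gamma> t - \<gamma> s) \<le> L * \<bar>t - s\<bar>"
    and gK: "\<And>s t. s \<le> t \<Longrightarrow> t - s \<le> \<rho> \<Longrightarrow> N (\<gamma> t - \<gamma> s) \<le> K * (t - s)"
    using polygon_exists[of ys] by blast
  \<comment> \<open>\<open>R\<close> collects the mean speeds, so \<open>M\<close> is the least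
    Lipschitz constant of \<open>\<gamma>\<close>.\<close>
  define R where "R = {N (\<gamma> t - \<gamma> s) / (t - s) | s t. s < t}"
  define M where "M = Sup R"
  have bdd: "bdd_above R"
  proof (rule bdd_aboveI)
    fix x assume "x \<in> R"
    then obtain s t where "x = N (\<gamma> t - \<gamma> s) / (t - s)" "s < t"
      by (auto simp: R_def)
    then show "x \<le> L"
      using gL[of t s] by (simp add: pos_divide_le_eq)
  qed
  \<comment> \<open>Within unit time the polygon gets from 0 to \<open>sum_list ys\<close>, which
    forces \<open>M\<close> above \<open>C\<close>.\<close>
  have "N (\<gamma> 1 - \<gamma> 0) / (1 - 0) \<in> R"
    unfolding R_def by (intro CollectI exI conjI) (rule refl, simp)
  then have "N (\<gamma> 1 - \<gamma> 0) / (1 - 0) \<le> M"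
    unfolding M_def using bdd by (rule cSup_upper)
  then have M: "C < M"
    using ys g0[of 0] g1[of 1] by simp
  have le_M: "N (\<gamma> t - \<gamma> s) \<le> M * \<bar>t - s\<bar>" for s t
  proof -
    have *: "N (\<gamma> t - \<gamma> s) \<le> M * \<bar>t - s\<bar>" if "s < t" for s t
    proof -
      have "N (\<gamma> t - \<gamma> s) / (t - s) \<le> M"
        unfolding M_def using bdd that by (intro cSup_upper) (auto simp: R_def)
      then show ?thesis
        using that by (simp add: field_simps)
    qed
    show ?thesis
      using *[of s t] *[of t s] qnorm_minus_commute[of "\<gamma> t" "\<gamma> s"]
      by (cases s t rule: linorder_cases) auto
  qed
  have loc: "N (\<gamma> t - \<gamma> s) \<le> K * \<bar>t - s\<bar>" if "\<bar>t - s\<bar> \<le> \<rho>" for s t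
    using gK[of s t] gK[of t s] qnorm_minus_commute[of "\<gamma> t" "\<gamma> s"] that
    by (cases "s \<le> t") auto
  have "\<theta> * M < Sup R"
    using M C assms(3) by (simp flip: M_def)
  moreover have "R \<noteq> {}"
    using \<open>N (\<gamma> 1 - \<gamma> 0) / (1 - 0) \<in> R\<close> by blast
  ultimately obtain x where "x \<in> R" "\<theta> * M < x"
    by (rule less_cSupE)
  then obtain a b where ab: "a < b" "\<theta> * M < N (\<gamma> b - \<gamma> a) / (b - a)"
    by (auto simp: R_def)
  define h where "h = b - a"
  have h: "h > 0"
    using ab by (simp add: h_def)
  \<comment> \<open>The affine substitution carries 0 and 1 to \<open>a\<close> and
    \<open>b\<close>; dividing by \<open>M * h\<close> makes the Lipschitz constant 1.\<close>
  define \<phi> where "\<phi> t = smul (of_real (1 / (M * h))) (\<gamma> (a + h * t))" for t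
  have \<phi>: "N (\<phi> t - \<phi> s) = N (\<gamma> (a + h * t) - \<gamma> (a + h * s)) / (M * h)" for s t
    using M C h
    by (simp add: \<phi>_def scale_right_diff_distrib[symmetric] qnorm_scale norm_divide norm_mult)
  have hd: "\<bar>(a + h * t) - (a + h * s)\<bar> = h * \<bar>t - s\<bar>" for s t
    using h by (simp add: right_diff_distrib[symmetric] abs_mult)
  have "N (\<phi> t - \<phi> s) \<le> \<bar>t - s\<bar>" for s t
    using le_M[of "a + h * t" "a + h * s"] M C h unfolding \<phi> hd
    by (simp add: field_simps)
  moreover have "N (\<phi> t - \<phi> s) \<le> \<delta> * \<bar>t - s\<bar>" if "\<bar>t - s\<bar> \<le> \<rho> / h" for s t
  proof -
    have "h * \<bar>t - s\<bar> \<le> \<rho>"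
      using that h by (simp add: field_simps)
    then have "N (\<phi> t - \<phi> s) \<le> K * (h * \<bar>t - s\<bar>) / (M * h)"
      using loc[of "a + h * t" "a + h * s"] M C h unfolding \<phi> hd
      by (intro divide_right_mono) auto
    also have "\<dots> = K / M * \<bar>t - s\<bar>"
      using h by simp
    also have "\<dots> \<le> K / C * \<bar>t - s\<bar>"
      using M C K_ge_1 by (intro mult_right_mono divide_left_mono) auto
    also have "K / C = \<delta>"
      using K_ge_1 by (simp add: C_def)
    finally show ?thesis .
  qed
  moreover have "\<theta> \<le> N (\<phi> 1 - \<phi> 0)"
    using ab M C h unfolding \<phi> by (simp add: h_def field_simps)
  ultimately show ?thesis
    using \<rho> h by (intro exI[of _ \<phi>] exI[of _ "\<rho> / h"]) auto
qed

text \<open>Composing the slow arc with a triangle wave keeps it slow and makes it bounded. Near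
  every \<open>s\<close> the curve visits both ends of the arc. Their difference, compared through
  \<open>g s\<close>, costs a factor \<open>K\<close>, and one of the two ends accounts for at least
  half of it.\<close>

lemma slow_oscillation_exists:
  assumes "\<not> locally_convex smul N" and "0 < \<delta>" and "\<theta> < 1"
  shows "\<exists>g \<rho>. 0 < \<rho> \<and> \<rho> \<le> 1 \<and> (\<forall>s t. N (g t - g s) \<le> \<bar>t - s\<bar>) \<and> (\<forall>s t. N (g t - g s) \<le> 1) \<and>
    (\<forall>s t. \<bar>t - s\<bar> \<le> \<rho> \<longrightarrow> N (g t - g s) \<le> \<delta> * \<bar>t - s\<bar>) \<and>
    (\<forall>s. \<exists>t. \<bar>t - s\<bar> \<le> 1 \<and> \<theta> / (2 * K) \<le> N (g t - g s))"
proof -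
  obtain \<gamma> \<rho> where \<rho>: "0 < \<rho>" and gL: "\<And>s t. N (\<gamma> t - \<gamma> s) \<le> \<bar>t - s\<bar>"
    and gs: "\<And>s t. \<bar>t - s\<bar> \<le> \<rho> \<Longrightarrow> N (\<gamma> t - \<gamma> s) \<le> \<delta> * \<bar>t - s\<bar>"
    and g1: "\<theta> \<le> N (\<gamma> 1 - \<gamma> 0)"
    using slow_arc_exists[OF assms] by blast
  \<comment> \<open>\<open>w\<close> is the triangle wave of period 2, which takes the values 0 and 1 within distance 1
    of every point.\<close>
  define E where "E = range (\<lambda>k::int. 2 * real_of_int k)"
  define w where "w t = infdist t E" for t :: real
  have Ene: "E \<noteq> {}"
    by (simp add: E_def)
  have w_lip: "\<bar>w t - w s\<bar> \<le> \<bar>t - s\<bar>" for s t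
    unfolding w_def using infdist_triangle_abs[of t E s] by (simp add: dist_real_def)
  have near: "\<exists>k::int. \<bar>2 * real_of_int k - s\<bar> \<le> 1" for s :: real
    using of_int_round_abs_le[of "s / 2"] by (intro exI[of _ "round (s / 2)"]) linarith
  have w0: "w (2 * real_of_int k) = 0" for k
    unfolding w_def by (rule infdist_zero) (simp add: E_def)
  have w_le: "w t \<le> 1" for t
  proof -
    obtain k :: int where k: "\<bar>2 * real_of_int k - t\<bar> \<le> 1"
      using near by blast
    have "w t \<le> dist t (2 * real_of_int k)"
      unfolding w_def by (rule infdist_le) (simp add: E_def)
    then show ?thesis
      using k by (simp add: dist_real_def)
  qed
  have w1: "w (2 * real_of_int k + 1) = 1" for k
  proof -
    have "1 \<le> dist (2 * real_of_int k + 1) (2 * real_of_int m)" for m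
    proof -
      have "1 \<le> \<bar>2 * k + 1 - 2 * m\<bar>"
        by presburger
      then have "1 \<le> \<bar>real_of_int (2 * k + 1 - 2 * m)\<bar>"
        by linarith
      then show ?thesis
        by (simp add: dist_real_def)
    qed
    then have "1 \<le> w (2 * real_of_int k + 1)"
      unfolding w_def infdist_notempty[OF Ene] using Ene
      by (intro cINF_greatest) (auto simp: E_def)
    then show ?thesis
      using w_le[of "2 * real_of_int k + 1"] by simp
  qed
  have w_bound: "\<bar>w t - w s\<bar> \<le> 1" for s t
    using w_le[of s] w_le[of t] infdist_nonneg[of s E] infdist_nonneg[of t E]
    by (simp add: w_def)
  define g where "g t = \<gamma> (w t)" for t
  have "N (g t - g s) \<le> \<bar>t - s\<bar>" for s t
    using gL[of "w t" "w s"] w_lip[of t s] by (simp add: g_def)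
  moreover have "N (g t - g s) \<le> 1" for s t
    using gL[of "w t" "w s"] w_bound[of t s] by (simp add: g_def)
  \<comment> \<open>The cap at 1 keeps each later scale \<open>r i = \<rho> i * \<epsilon> i\<close>
    below \<open>\<epsilon> i\<close>.\<close>
  moreover have "N (g t - g s) \<le> \<delta> * \<bar>t - s\<bar>" if "\<bar>t - s\<bar> \<le> min \<rho> 1" for s t
  proof -
    have "N (g t - g s) \<le> \<delta> * \<bar>w t - w s\<bar>"
      using gs[of "w t" "w s"] w_lip[of t s] that by (simp add: g_def)
    also have "\<dots> \<le> \<delta> * \<bar>t - s\<bar>"
      using w_lip[of t s] assms(2) by (intro mult_left_mono) auto
    finally show ?thesis .
  qed
  moreover have "\<exists>t. \<bar>t - s\<bar> \<le> 1 \<and> \<theta> / (2 * K) \<le> N (g t - g s)" for s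
  proof -
    \<comment> \<open>Applying \<open>near\<close> to \<open>s - 1\<close> and adding 1 gives an odd
      integer within distance 1 of \<open>s\<close>, where the wave equals 1.\<close>
    obtain k m :: int where k: "\<bar>2 * real_of_int k - s\<bar> \<le> 1"
      and m: "\<bar>2 * real_of_int m - (s - 1)\<bar> \<le> 1"
      using near by blast
    let ?u = "2 * real_of_int k" and ?v = "2 * real_of_int m + 1"
    have "\<theta> \<le> K * (N (g ?v - g s) + N (g s - g ?u))"
      using g1 qnorm_diff_le[of "g ?v" "g ?u" "g s"] by (simp add: g_def w0 w1)
    then have "\<theta> / K \<le> N (g ?v - g s) + N (g ?u - g s)"
      using K_ge_1 qnorm_minus_commute[of "g s" "g ?u"] by (simp add: field_simps)
    then have "\<theta> / (2 * K) \<le> N (g ?v - g s) \<or> \<theta> / (2 * K) \<le> N (g ?u - g s)"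
      by (simp add: field_simps) linarith
    moreover have "\<bar>?v - s\<bar> \<le> 1"
      using m by simp
    ultimately show ?thesis
      using k by blast
  qed
  ultimately show ?thesis
    using \<rho> by (intro exI[of _ g] exI[of _ "min \<rho> 1"]) auto
qed

section \<open>Rapidly decaying sums and series\<close>

text \<open>The factors \<open>(2 * K) ^ Suc i\<close> in the head and the ratio \<open>q\<close> in
  the tail absorb the weights of \<open>qnorm_sum_le\<close> and leave geometric series of ratio
  1/2. The bound is therefore independent of \<open>n\<close>, as needed for passing to a
  limit.\<close>

lemma qnorm_sum_head_tail_le:
  fixes x :: "nat \<Rightarrow> 'a"
  assumes "0 \<le> c" "0 \<le> h" "0 \<le> q" "K * q \<le> 1 / 2" "0 \<le> e"
    and head: "\<And>i. i < j \<Longrightarrow> N (x i) \<le> c / (2 * K) ^ Suc i * h"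
    and tail: "\<And>i. N (x (j + i)) \<le> q ^ i * e"
    and "j \<le> n"
  shows "N (\<Sum>i<n. x i) \<le> K * (c * h + 2 * K * e)"
proof -
  have K: "K > 0"
    using K_ge_1 by simp
  have geom: "(\<Sum>i<m. (1 / 2) ^ i) \<le> (2::real)" for m
    using sum_le_suminf[of "\<lambda>i. (1 / 2 :: real) ^ i" "{..<m}"]
    by (simp add: suminf_geometric)
  have "N (\<Sum>i<j. x i) \<le> (\<Sum>i<j. K ^ Suc i * N (x i))"
    by (rule qnorm_sum_le)
  also have "\<dots> \<le> (\<Sum>i<j. c * h / 2 * (1 / 2) ^ i)"
  proof (rule sum_mono)
    fix i assume "i \<in> {..<j}"
    then have "K ^ Suc i * N (x i) \<le> K ^ Suc i * (c / (2 * K) ^ Suc i * h)"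
      using K by (intro mult_left_mono head) auto
    also have "\<dots> = c * h / 2 * (1 / 2) ^ i"
      using K by (simp add: power_mult_distrib power_divide)
    finally show "K ^ Suc i * N (x i) \<le> c * h / 2 * (1 / 2) ^ i" .
  qed
  also have "\<dots> \<le> c * h / 2 * 2"
    unfolding sum_distrib_left[symmetric] using assms by (intro mult_left_mono geom) auto
  finally have 1: "N (\<Sum>i<j. x i) \<le> c * h"
    by simp
  have "N (\<Sum>i<n - j. x (j + i)) \<le> (\<Sum>i<n - j. K ^ Suc i * N (x (j + i)))"
    by (rule qnorm_sum_le)
  also have "\<dots> \<le> (\<Sum>i<n - j. K * e * (1 / 2) ^ i)"
  proof (rule sum_mono)
    fix i
    have "K ^ Suc i * N (x (j + i)) \<le> K ^ Suc i * (q ^ i * e)"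
      using K by (intro mult_left_mono tail) auto
    also have "\<dots> = K * e * (K * q) ^ i"
      by (simp add: power_mult_distrib)
    also have "\<dots> \<le> K * e * (1 / 2) ^ i"
      using K assms by (intro mult_left_mono power_mono) auto
    finally show "K ^ Suc i * N (x (j + i)) \<le> K * e * (1 / 2) ^ i" .
  qed
  also have "\<dots> \<le> K * e * 2"
    unfolding sum_distrib_left[symmetric] using K assms by (intro mult_left_mono geom) auto
  finally have 2: "N (\<Sum>i<n - j. x (j + i)) \<le> 2 * K * e"
    by simp
  have "(\<Sum>i<n. x i) = (\<Sum>i<j. x i) + (\<Sum>i<n - j. x (j + i))"
    using sum.atLeastLessThan_concat[of 0 j n x] \<open>j \<le> n\<close>
      sum.shift_bounds_nat_ivl[of x 0 j "n - j"]
    by (simp add: atLeast0LessThan add.commute)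
  then have "N (\<Sum>i<n. x i) \<le> K * (N (\<Sum>i<j. x i) + N (\<Sum>i<n - j. x (j + i)))"
    using qnorm_add_le by simp
  also have "\<dots> \<le> K * (c * h + 2 * K * e)"
    using 1 2 K by (intro mult_left_mono add_mono) auto
  finally show ?thesis .
qed

end

context quasi_banach_space
begin

text \<open>This translates completeness from the topology to \<open>N\<close>. Sets of the form
  \<open>{y. N (y - l) < e}\<close> need not be open, so \<open>qball_nhd\<close> supplies an open
  set inside.\<close>

lemma cauchy_limit_exists:
  assumes "\<And>e. 0 < e \<Longrightarrow> \<exists>M. \<forall>m\<ge>M. \<forall>n\<ge>M. N (X m - X n) < e"
  shows "\<exists>l. \<forall>e>0. \<forall>\<^sub>F n in sequentially. N (X n - l) < e"
proof -
  have "\<exists>l. limitin (qnorm_topology N) X l sequentially"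
  proof (rule qnorm_complete)
    fix U assume "openin (qnorm_topology N) U" "0 \<in> U"
    then obtain e where "e > 0" "\<And>y. N y < e \<Longrightarrow> y \<in> U"
      by (force simp: openin_qnorm_topology)
    then show "\<exists>M. \<forall>m\<ge>M. \<forall>n\<ge>M. X m - X n \<in> U"
      using assms by meson
  qed
  then obtain l where l: "limitin (qnorm_topology N) X l sequentially" ..
  have "\<forall>\<^sub>F n in sequentially. N (X n - l) < e" if "e > 0" for e
  proof -
    obtain U where U: "openin (qnorm_topology N) U" "l \<in> U" "U \<subseteq> {y. N (y - l) < e}"
      using qball_nhd[OF \<open>e > 0\<close>, of l] by blast
    then have "\<forall>\<^sub>F n in sequentially. X n \<in> U"
      using l by (auto simp: limitin_def)
    then show ?thesis
      by (rule eventually_mono) (use U in auto)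
  qed
  then show ?thesis
    by blast
qed

lemma fast_series_converges:
  fixes x :: "nat \<Rightarrow> 'a"
  assumes "0 < q" "K * q \<le> 1 / 2" "0 \<le> e" and x: "\<And>i. N (x i) \<le> q ^ i * e"
  shows "\<exists>l. \<forall>d>0. \<forall>\<^sub>F n in sequentially. N ((\<Sum>i<n. x i) - l) < d"
proof (rule cauchy_limit_exists)
  fix d :: real assume d: "d > 0"
  have K: "K > 0"
    using K_ge_1 by simp
  have "1 * q \<le> K * q"
    using K_ge_1 assms(1) by (intro mult_right_mono) auto
  then have q1: "q < 1"
    using assms by linarith
  have "(\<lambda>M. K * (2 * K * (q ^ M * e))) \<longlonglongrightarrow> K * (2 * K * (0 * e))"
    by (intro tendsto_intros LIMSEQ_realpow_zero) (use assms q1 in auto)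
  then have "\<forall>\<^sub>F M in sequentially. K * (2 * K * (q ^ M * e)) < d"
    by (rule order_tendstoD(2)) (use d in simp)
  then obtain M where M: "K * (2 * K * (q ^ M * e)) < d"
    by (auto simp: eventually_sequentially)
  have *: "N ((\<Sum>i<n. x i) - (\<Sum>i<m. x i)) < d" if "M \<le> m" "m \<le> n" for m n
  proof -
    \<comment> \<open>Zeroing the first \<open>m\<close> terms turns a difference of partial sums
      into a sum whose head vanishes.\<close>
    define y where "y i = (if i < m then 0 else x i)" for i
    have "N (\<Sum>i<n. y i) \<le> K * (0 * 0 + 2 * K * (q ^ m * e))"
    proof (rule qnorm_sum_head_tail_le)
      show "N (y (m + i)) \<le> q ^ i * (q ^ m * e)" for i
        using x[of "m + i"] by (simp add: y_def power_add mult_ac)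
    qed (use assms that in \<open>auto simp: y_def\<close>)
    also have "\<dots> = K * (2 * K * (q ^ m * e))"
      by simp
    also have "\<dots> \<le> K * (2 * K * (q ^ M * e))"
      using that K assms q1
      by (intro mult_left_mono mult_right_mono power_decreasing) auto
    also note M
    also have "(\<Sum>i<n. y i) = (\<Sum>i\<in>{m..<n}. x i)"
      using that by (intro sum.mono_neutral_cong_right) (auto simp: y_def)
    also have "\<dots> = (\<Sum>i<n. x i) - (\<Sum>i<m. x i)"
      using sum_diff_nat_ivl[of 0 m n x] that by (simp add: atLeast0LessThan)
    finally show ?thesis .
  qed
  have "N ((\<Sum>i<m. x i) - (\<Sum>i<n. x i)) < d" if "m \<ge> M" "n \<ge> M" for m n
    using *[of m n] *[of n m] that qnorm_minus_commute[of "\<Sum>i<m. x i" "\<Sum>i<n. x i"]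
    by (cases "m \<le> n") auto
  then show "\<exists>M. \<forall>m\<ge>M. \<forall>n\<ge>M. N ((\<Sum>i<m. x i) - (\<Sum>i<n. x i)) < d"
    by blast
qed

section \<open>Superposition of oscillations on separated scales\<close>

text \<open>This is the pointwise form of the result, from which the bounds on the suprema follow
  directly.\<close>

lemma oscillating_curve_exists:
  assumes "\<not> locally_convex smul N" and "0 < \<eta>" and "\<eta> < 1"
  shows "\<exists>F r \<epsilon>. lipschitz_curve N F \<and> decreasing_to_zero r \<and> decreasing_to_zero \<epsilon> \<and>
    (\<forall>j s t. \<bar>t - s\<bar> \<le> r j \<longrightarrow> N (F t - F s) \<le> \<eta> * r j) \<and>
    (\<forall>j s. \<exists>t. \<bar>t - s\<bar> \<le> \<epsilon> j \<and> (1 - \<eta>) / (2 * K ^ 3) * \<epsilon> j \<le> N (F t - F s))"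
proof -
  have K: "K > 0" "1 \<le> K"
    using K_ge_1 by auto
  \<comment> \<open>The constants satisfy \<open>c + 2 * K * q = \<eta> / (4 * K ^ 3)\<close>. With
    one factor \<open>K\<close> from \<open>qnorm_sum_head_tail_le\<close> and another from removing
    the unwanted terms, the relative error becomes \<open>\<eta> / (4 * K)\<close>.\<close>
  define c where "c = \<eta> / (8 * K ^ 3)"
  define q where "q = \<eta> / (16 * K ^ 4)"
  define \<delta> where "\<delta> i = c / (2 * K) ^ Suc i" for i
  have c: "c > 0" and q: "q > 0"
    using assms(2) K by (auto simp: c_def q_def)
  have \<delta>: "\<delta> i > 0" for i
    using c K by (simp add: \<delta>_def)
  have cq: "c + 2 * K * q = \<eta> / (4 * K ^ 3)"
    using K by (simp add: c_def q_def field_simps power3_eq_cube power4_eq_xxxx)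
  have Kq: "K * q \<le> 1 / 2"
  proof -
    have "K * q = \<eta> / (16 * K ^ 3)"
      using K by (simp add: q_def field_simps power3_eq_cube power4_eq_xxxx)
    also have "\<dots> \<le> 1 / (16 * 1)"
      using assms one_le_power[OF K(2), of 3] by (intro frac_le) auto
    finally show ?thesis
      by simp
  qed
  have "1 * q \<le> K * q"
    using K q by (intro mult_right_mono) auto
  then have q1: "q < 1"
    using Kq by linarith
  \<comment> \<open>Half of \<open>\<eta>\<close> is given up here; the other half pays for the
    unwanted terms, as \<open>(1 - \<eta> / 2) / (2 * K) - \<eta> / (4 * K) = (1 - \<eta>) / (2 *
    K)\<close>.\<close>
  have "\<forall>i. \<exists>g \<rho>. 0 < \<rho> \<and> \<rho> \<le> 1 \<and> (\<forall>s t. N (g t - g s) \<le> \<bar>t - s\<bar>) \<and>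
    (\<forall>s t. N (g t - g s) \<le> 1) \<and>
    (\<forall>s t. \<bar>t - s\<bar> \<le> \<rho> \<longrightarrow> N (g t - g s) \<le> \<delta> i * \<bar>t - s\<bar>) \<and>
    (\<forall>s. \<exists>t. \<bar>t - s\<bar> \<le> 1 \<and> (1 - \<eta> / 2) / (2 * K) \<le> N (g t - g s))"
    using assms \<delta> by (intro allI slow_oscillation_exists) auto
  then obtain g \<rho> where \<rho>: "\<And>i. 0 < \<rho> i" "\<And>i. \<rho> i \<le> 1"
    and g_lip: "\<And>i s t. N (g i t - g i s) \<le> \<bar>t - s\<bar>"
    and g_le1: "\<And>i s t. N (g i t - g i s) \<le> 1"
    and g_slow: "\<And>i s t. \<bar>t - s\<bar> \<le> \<rho> i \<Longrightarrow> N (g i t - g i s) \<le> \<delta> i * \<bar>t - s\<bar>"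
    and g_osc: "\<And>i s. \<exists>t. \<bar>t - s\<bar> \<le> 1 \<and> (1 - \<eta> / 2) / (2 * K) \<le> N (g i t - g i s)"
    by metis
  \<comment> \<open>The product is chosen so that \<open>\<epsilon> (Suc i) = q * r i\<close>. The
    scales then interlace: \<open>\<epsilon> (Suc i) < r i \<le> \<epsilon> i\<close>.\<close>
  define \<epsilon> where "\<epsilon> i = (\<Prod>k<i. q * \<rho> k)" for i :: nat
  define r where "r i = \<rho> i * \<epsilon> i" for i
  have \<epsilon>: "\<epsilon> i > 0" for i
    using \<rho> q by (auto simp: \<epsilon>_def intro!: prod_pos)
  have r: "r i > 0" "r i \<le> \<epsilon> i" for i
    using \<rho>[of i] \<epsilon>[of i] by (auto simp: r_def mult_le_cancel_right1)
  have \<epsilon>_Suc: "\<epsilon> (Suc i) = q * r i" for i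
    by (simp add: \<epsilon>_def r_def)
  have qr: "q * r i < r i" for i
    using q1 r[of i] by simp
  have \<epsilon>_Suc_le: "\<epsilon> (Suc i) \<le> q * \<epsilon> i" for i
    unfolding \<epsilon>_Suc using q r[of i] by (intro mult_left_mono) auto
  have \<epsilon>_geom: "\<epsilon> (j + i) \<le> q ^ i * \<epsilon> j" for i j
  proof (induction i)
    case (Suc i)
    have "\<epsilon> (j + Suc i) \<le> q * (q ^ i * \<epsilon> j)"
      using order_trans[OF \<epsilon>_Suc_le[of "j + i"] mult_left_mono[OF Suc, of q]] q by simp
    then show ?case
      by (simp add: mult.assoc)
  qed simp
  have "(\<lambda>i. q ^ i * \<epsilon> 0) \<longlonglongrightarrow> 0 * \<epsilon> 0"
    by (intro tendsto_intros LIMSEQ_realpow_zero) (use q q1 in auto)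
  then have geom0: "(\<lambda>i. q ^ i * \<epsilon> 0) \<longlonglongrightarrow> 0"
    by simp
  have \<epsilon>_lim: "\<epsilon> \<longlonglongrightarrow> 0"
    by (rule tendsto_sandwich[OF _ _ tendsto_const geom0])
      (use \<epsilon> \<epsilon>_geom[of 0] in \<open>auto intro!: always_eventually less_imp_le\<close>)
  have r_lim: "r \<longlonglongrightarrow> 0"
    by (rule tendsto_sandwich[OF _ _ tendsto_const \<epsilon>_lim])
      (use r in \<open>auto intro!: always_eventually less_imp_le\<close>)
  have \<epsilon>_dec: "decreasing_to_zero \<epsilon>"
    unfolding decreasing_to_zero_def
    using \<epsilon> \<epsilon>_lim by (auto simp: \<epsilon>_Suc intro: less_le_trans[OF qr r(2)])
  have r_dec: "decreasing_to_zero r"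
    unfolding decreasing_to_zero_def
    using r(1) r_lim by (auto intro: le_less_trans[OF r(2)[of "Suc _", unfolded \<epsilon>_Suc] qr])
  have r_mono: "r j \<le> r i" if "i \<le> j" for i j
    by (rule lift_Suc_antimono_le[OF _ that])
      (use r_dec in \<open>auto simp: decreasing_to_zero_def less_imp_le\<close>)
  \<comment> \<open>Scaling time and values alike preserves the Lipschitz constant 1, bounds the
    oscillation by \<open>\<epsilon> i\<close> and makes \<open>f i\<close> slow up to scale
    \<open>r i\<close>.\<close>
  define f where "f i t = smul (of_real (\<epsilon> i)) (g i (t / \<epsilon> i))" for i t
  have fN: "N (f i t - f i s) = \<epsilon> i * N (g i (t / \<epsilon> i) - g i (s / \<epsilon> i))" for i s t
    using \<epsilon>[of i] by (simp add: f_def scale_right_diff_distrib[symmetric] qnorm_scale)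
  have dist_scaled: "\<bar>t / \<epsilon> i - s / \<epsilon> i\<bar> = \<bar>t - s\<bar> / \<epsilon> i" for i s t
    using \<epsilon>[of i] by (simp add: diff_divide_distrib[symmetric] abs_divide)
  have f_lip: "N (f i t - f i s) \<le> \<bar>t - s\<bar>" for i s t
    using g_lip[where i=i and t="t / \<epsilon> i" and s="s / \<epsilon> i"] \<epsilon>[of i]
    unfolding fN dist_scaled by (simp add: field_simps)
  have f_bound: "N (f i t - f i s) \<le> \<epsilon> i" for i s t
    using g_le1[of i "t / \<epsilon> i" "s / \<epsilon> i"] \<epsilon>[of i] unfolding fN by simp
  have f_slow: "N (f i t - f i s) \<le> \<delta> i * h" if "\<bar>t - s\<bar> \<le> h" "h \<le> r i" for i s t h
  proof -
    have "\<bar>t - s\<bar> / \<epsilon> i \<le> \<rho> i"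
      using that \<epsilon>[of i] by (simp add: r_def field_simps)
    then have "N (g i (t / \<epsilon> i) - g i (s / \<epsilon> i)) \<le> \<delta> i * (\<bar>t - s\<bar> / \<epsilon> i)"
      using g_slow[where i=i and t="t / \<epsilon> i" and s="s / \<epsilon> i"] unfolding dist_scaled by simp
    then have "N (f i t - f i s) \<le> \<delta> i * \<bar>t - s\<bar>"
      unfolding fN using \<epsilon>[of i] by (simp add: field_simps)
    also have "\<dots> \<le> \<delta> i * h"
      using \<delta>[of i] that by (intro mult_left_mono) auto
    finally show ?thesis .
  qed
  \<comment> \<open>Only increments of \<open>g i\<close> are controlled, so every term is based at
    time 0; this cancels in \<open>F t - F s\<close>.\<close>
  have "\<exists>l. \<forall>d>0. \<forall>\<^sub>F n in sequentially. N ((\<Sum>i<n. f i t - f i 0) - l) < d" for t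
  proof (rule fast_series_converges[OF q Kq])
    show "N (f i t - f i 0) \<le> q ^ i * \<epsilon> 0" for i
      using f_bound[of i t 0] \<epsilon>_geom[of 0 i] by simp
  qed (use \<epsilon>[of 0] in simp)
  then obtain F where F: "\<And>t d. d > 0 \<Longrightarrow>
      \<forall>\<^sub>F n in sequentially. N ((\<Sum>i<n. f i t - f i 0) - F t) < d"
    by metis
  define D where "D s t i = f i t - f i s" for s t i
  have F_approx: "\<exists>n\<ge>j. N ((F t - F s) - (\<Sum>i<n. D s t i)) \<le> d" if "d > 0" for s t j d
  proof -
    have "d / (2 * K) > 0"
      using that K by simp
    then have "\<forall>\<^sub>F n in sequentially. N ((\<Sum>i<n. f i t - f i 0) - F t) < d / (2 * K) \<and>
        N ((\<Sum>i<n. f i s - f i 0) - F s) < d / (2 * K) \<and> n \<ge> j"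
      by (intro eventually_conj F eventually_ge_at_top)
    then obtain n where n: "N ((\<Sum>i<n. f i t - f i 0) - F t) < d / (2 * K)"
      "N ((\<Sum>i<n. f i s - f i 0) - F s) < d / (2 * K)" "n \<ge> j"
      by (auto simp: eventually_sequentially)
    have split: "(F t - F s) - (\<Sum>i<n. D s t i) =
        (F t - (\<Sum>i<n. f i t - f i 0)) + ((\<Sum>i<n. f i s - f i 0) - F s)"
      by (simp add: D_def sum_subtractf)
    have "N ((F t - F s) - (\<Sum>i<n. D s t i)) \<le>
        K * (N (F t - (\<Sum>i<n. f i t - f i 0)) + N ((\<Sum>i<n. f i s - f i 0) - F s))"
      unfolding split by (rule qnorm_add_le)
    also have "\<dots> \<le> K * (d / (2 * K) + d / (2 * K))"
      using n K by (intro mult_left_mono add_mono)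
        (auto simp: qnorm_minus_commute[of "F t"])
    also have "\<dots> = d"
      using K by simp
    finally show ?thesis
      using n(3) by blast
  qed
  \<comment> \<open>Comparison with one late partial sum costs a factor \<open>K\<close>, in place
    of continuity of \<open>N\<close>.\<close>
  have F_le: "N (F t - F s) \<le> K * B"
    if B: "\<And>n. n \<ge> j \<Longrightarrow> N (\<Sum>i<n. D s t i) \<le> B" for s t j B
  proof (rule field_le_epsilon)
    fix e :: real assume "e > 0"
    then obtain n where n: "n \<ge> j" "N ((F t - F s) - (\<Sum>i<n. D s t i)) \<le> e / K"
      using F_approx[where d="e / K" and s=s and t=t and j=j] \<open>e > 0\<close> K by auto
    have "N (F t - F s) \<le> K * (N ((F t - F s) - (\<Sum>i<n. D s t i)) + N (\<Sum>i<n. D s t i))"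
      using qnorm_diff_le[of "F t - F s" 0] by simp
    also have "\<dots> \<le> K * (e / K + B)"
      using n B[OF n(1)] K by (intro mult_left_mono add_mono) auto
    also have "\<dots> = K * B + e"
      using K by (simp add: field_simps)
    finally show "N (F t - F s) \<le> K * B + e" .
  qed
  have small_eq: "K * (c * h + 2 * K * (q * h)) = \<eta> / (4 * K ^ 2) * h" for h
  proof -
    have "K * (c * h + 2 * K * (q * h)) = K * (c + 2 * K * q) * h"
      by (simp add: algebra_simps)
    also have "\<dots> = \<eta> / (4 * K ^ 2) * h"
      unfolding cq using K by (simp add: field_simps power3_eq_cube power2_eq_square)
    finally show ?thesis .
  qed
  have tail: "N (D s t (j + i)) \<le> q ^ i * \<epsilon> j" for s t i j
    unfolding D_def by (rule order_trans[OF f_bound \<epsilon>_geom])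

  \<comment> \<open>The slow scales\<close>
  have slow: "N (F t - F s) \<le> \<eta> * r j" if st: "\<bar>t - s\<bar> \<le> r j" for j s t
  proof -
    \<comment> \<open>Terms up to \<open>j\<close> are slow since \<open>r j \<le> r i\<close>; all
      later ones are bounded by multiples of \<open>\<epsilon> (Suc j) = q * r j\<close>.\<close>
    have "N (\<Sum>i<n. D s t i) \<le> K * (c * r j + 2 * K * \<epsilon> (Suc j))" if "n \<ge> Suc j" for n
    proof (rule qnorm_sum_head_tail_le[where q=q and j="Suc j"])
      show "N (D s t i) \<le> c / (2 * K) ^ Suc i * r j" if "i < Suc j" for i
        using f_slow[OF st, of i] r_mono[of i j] that by (simp add: D_def \<delta>_def)
    qed (use c q r[of j] \<epsilon>[of "Suc j"] Kq tail[of s t "Suc j"] that in auto)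
    then have "N (F t - F s) \<le> K * (\<eta> / (4 * K ^ 2) * r j)"
      unfolding \<epsilon>_Suc small_eq by (rule F_le)
    also have "\<dots> = \<eta> * r j * (1 / (4 * K))"
      using K by (simp add: power2_eq_square)
    also have "\<dots> \<le> \<eta> * r j * 1"
      using K r[of j] assms by (intro mult_left_mono) auto
    finally show ?thesis
      by simp
  qed

  \<comment> \<open>The oscillating scales\<close>
  have fast: "\<exists>t. \<bar>t - s\<bar> \<le> \<epsilon> j \<and> (1 - \<eta>) / (2 * K ^ 3) * \<epsilon> j \<le> N (F t - F s)" for j s
  proof -
    obtain u where u: "\<bar>u - s / \<epsilon> j\<bar> \<le> 1"
      "(1 - \<eta> / 2) / (2 * K) \<le> N (g j u - g j (s / \<epsilon> j))"
      using g_osc by blast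
    define t where "t = \<epsilon> j * u"
    have u_eq: "u = t / \<epsilon> j"
      using \<epsilon>[of j] by (simp add: t_def)
    have st: "\<bar>t - s\<bar> \<le> \<epsilon> j"
      using u(1) \<epsilon>[of j] unfolding u_eq dist_scaled by simp
    have big: "(1 - \<eta> / 2) / (2 * K) * \<epsilon> j \<le> N (D s t j)"
      using mult_right_mono[OF u(2), of "\<epsilon> j"] \<epsilon>[of j] unfolding D_def fN u_eq
      by (simp add: mult.commute)
    \<comment> \<open>\<open>D'\<close> drops the main term. Earlier terms are slow because
      \<open>\<epsilon> j \<le> r i\<close> for \<open>i < j\<close>, later ones are at most
      \<open>q * \<epsilon> j\<close>; the zeroed index \<open>j\<close> is counted in the
      head.\<close>
    define D' where "D' i = (if i = j then 0 else D s t i)" for i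
    have D': "N (\<Sum>i<n. D' i) \<le> \<eta> / (4 * K ^ 2) * \<epsilon> j" if "n \<ge> Suc j" for n
    proof -
      have "N (\<Sum>i<n. D' i) \<le> K * (c * \<epsilon> j + 2 * K * (q * \<epsilon> j))"
      proof (rule qnorm_sum_head_tail_le[where q=q and j="Suc j"])
        show "N (D' i) \<le> c / (2 * K) ^ Suc i * \<epsilon> j" if "i < Suc j" for i
        proof (cases "i = j")
          case True
          then show ?thesis
            using c K \<epsilon>[of j] by (simp add: D'_def)
        next
          case False
          then have "i < j"
            using that by simp
          then obtain k where k: "j = Suc k" "i \<le> k"
            by (cases j) auto
          then have "\<epsilon> j \<le> r i"
            using \<epsilon>_Suc[of k] qr[of k] r_mono[of i k] by simp
          then show ?thesis
            using f_slow[OF st] False by (simp add: D'_def D_def \<delta>_def)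
        qed
        show "N (D' (Suc j + i)) \<le> q ^ i * (q * \<epsilon> j)" for i
        proof -
          have "q ^ i * \<epsilon> (Suc j) \<le> q ^ i * (q * \<epsilon> j)"
            using q \<epsilon>_Suc_le[of j] by (intro mult_left_mono) auto
          then show ?thesis
            using tail[of s t "Suc j" i] by (simp add: D'_def)
        qed
      qed (use c q \<epsilon>[of j] Kq that in auto)
      then show ?thesis
        unfolding small_eq .
    qed
    \<comment> \<open>One factor \<open>K\<close> isolates the main term and one replaces the
      partial sum by \<open>F t - F s\<close>. Together with the \<open>2 * K\<close> from
      \<open>g_osc\<close> they produce \<open>2 * K ^ 3\<close>.\<close>
    have "(1 - \<eta> / 2) / (2 * K) * \<epsilon> j \<le> K\<^sup>2 * N (F t - F s) + \<eta> / (4 * K) * \<epsilon> j"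
    proof (rule field_le_epsilon)
      fix e :: real assume e: "e > 0"
      then obtain n where n: "n \<ge> Suc j" "N ((F t - F s) - (\<Sum>i<n. D s t i)) \<le> e / K\<^sup>2"
        using F_approx[where d="e / K\<^sup>2" and s=s and t=t and j="Suc j"] K by auto
      have "(\<Sum>i<n. D s t i) = (\<Sum>i<n. D' i) + D s t j"
      proof -
        have "(\<Sum>i<n. D s t i) = (\<Sum>i<n. D' i + (if i = j then D s t j else 0))"
          by (intro sum.cong) (auto simp: D'_def)
        also have "\<dots> = (\<Sum>i<n. D' i) + D s t j"
          using n(1) by (simp add: sum.distrib)
        finally show ?thesis .
      qed
      then have "N (D s t j) \<le> K * (N (\<Sum>i<n. D s t i) + N (\<Sum>i<n. D' i))"
        using qnorm_diff_le[of "\<Sum>i<n. D s t i" "\<Sum>i<n. D' i" 0]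
        by (simp add: qnorm_minus)
      also have "\<dots> \<le> K * (K * (N (F t - F s) + e / K\<^sup>2) + \<eta> / (4 * K ^ 2) * \<epsilon> j)"
      proof -
        have "N (\<Sum>i<n. D s t i) \<le>
            K * (N ((\<Sum>i<n. D s t i) - (F t - F s)) + N (F t - F s))"
          using qnorm_diff_le[of "\<Sum>i<n. D s t i" 0 "F t - F s"] by simp
        also have "\<dots> \<le> K * (e / K\<^sup>2 + N (F t - F s))"
          using n(2) K by (intro mult_left_mono add_mono)
            (auto simp: qnorm_minus_commute[of "\<Sum>i<n. D s t i"])
        finally show ?thesis
          using D'[OF n(1)] K by (intro mult_left_mono add_mono) (auto simp: add.commute)
      qed
      also have "\<dots> = K\<^sup>2 * N (F t - F s) + \<eta> / (4 * K) * \<epsilon> j + e"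
        using K by (simp add: field_simps power2_eq_square)
      finally show "(1 - \<eta> / 2) / (2 * K) * \<epsilon> j \<le>
          K\<^sup>2 * N (F t - F s) + \<eta> / (4 * K) * \<epsilon> j + e"
        using big by simp
    qed
    moreover have "(1 - \<eta>) / (2 * K) * \<epsilon> j =
        (1 - \<eta> / 2) / (2 * K) * \<epsilon> j - \<eta> / (4 * K) * \<epsilon> j"
      using K by (simp add: field_simps)
    ultimately have "(1 - \<eta>) / (2 * K) * \<epsilon> j / K\<^sup>2 \<le> K\<^sup>2 * N (F t - F s) / K\<^sup>2"
      by (intro divide_right_mono) auto
    then have "(1 - \<eta>) / (2 * K ^ 3) * \<epsilon> j \<le> N (F t - F s)"
      using K by (simp add: power3_eq_cube power2_eq_square mult_ac)
    then show ?thesis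
      using st by blast
  qed

  \<comment> \<open>The global Lipschitz bound\<close>
  have "N (F t - F s) \<le> K * (K * (1 + K * (c + 2 * K))) * \<bar>t - s\<bar>" for s t
  proof (cases "t = s")
    case False
    define h where "h = \<bar>t - s\<bar>"
    have h: "h > 0"
      using False by (simp add: h_def)
    have ex: "\<exists>j. \<epsilon> j < h"
      using order_tendstoD(2)[OF \<epsilon>_lim h] by (auto simp: eventually_sequentially)
    \<comment> \<open>By minimality \<open>h \<le> \<epsilon> (Suc i) < r i\<close> whenever
      \<open>Suc i < j\<close>, so these terms are slow, while those from \<open>j\<close> on are
      tiny. Writing the exceptional index as \<open>Suc i = j\<close> also covers
      \<open>j = 0\<close>, where there is none.\<close>
    define j where "j = (LEAST j. \<epsilon> j < h)"
    have j: "\<epsilon> j < h"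
      unfolding j_def using ex by (rule LeastI_ex)
    have j': "h \<le> \<epsilon> i" if "i < j" for i
      using not_less_Least[of i "\<lambda>j. \<epsilon> j < h"] that by (simp add: j_def)
    \<comment> \<open>The only term that is neither slow nor tiny on scale \<open>h\<close> is the one before \<open>j\<close>.\<close>
    define D' where "D' i = (if Suc i = j then 0 else D s t i)" for i
    have "N (\<Sum>i<n. D s t i) \<le> K * (h + K * (c * h + 2 * K * h))" if n: "n \<ge> j" for n
    proof -
      have "N (\<Sum>i<n. D' i) \<le> K * (c * h + 2 * K * h)"
      proof (rule qnorm_sum_head_tail_le[where q=q and j=j])
        show "N (D' i) \<le> c / (2 * K) ^ Suc i * h" if "i < j" for i
        proof (cases "Suc i = j")
          case True
          then show ?thesis
            using c K h by (simp add: D'_def)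
        next
          case False
          then have "h \<le> r i"
            using j'[of "Suc i"] that \<epsilon>_Suc[of i] qr[of i] by simp
          then show ?thesis
            using f_slow[of t s h i] False by (simp add: D'_def D_def \<delta>_def h_def)
        qed
        show "N (D' (j + i)) \<le> q ^ i * h" for i
        proof -
          have "q ^ i * \<epsilon> j \<le> q ^ i * h"
            using q j by (intro mult_left_mono) auto
          then show ?thesis
            using tail[of s t j i] by (simp add: D'_def)
        qed
      qed (use c q h Kq n in auto)
      moreover have "N (\<Sum>i<n. if Suc i = j then D s t i else 0) \<le> h"
      proof (cases j)
        case 0
        then show ?thesis
          using h by simp
      next
        case (Suc k)
        then show ?thesis
          using n f_lip[of k t s] by (simp add: D_def h_def)
      qed
      ultimately have bound: "K * (N (\<Sum>i<n. if Suc i = j then D s t i else 0) + N (\<Sum>i<n. D' i)) \<le>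
          K * (h + K * (c * h + 2 * K * h))"
        using K by (intro mult_left_mono add_mono) auto
      have split: "(\<Sum>i<n. D s t i) =
          (\<Sum>i<n. if Suc i = j then D s t i else 0) + (\<Sum>i<n. D' i)"
        unfolding sum.distrib[symmetric] by (rule sum.cong) (auto simp: D'_def)
      show ?thesis
        unfolding split by (rule order_trans[OF qnorm_add_le bound])
    qed
    then have "N (F t - F s) \<le> K * (K * (h + K * (c * h + 2 * K * h)))"
      by (rule F_le)
    then show ?thesis
      by (simp add: h_def algebra_simps)
  qed simp
  then have "lipschitz_curve N F"
    unfolding lipschitz_curve_def by blast
  then show ?thesis
    using r_dec \<epsilon>_dec slow fast by blast
qed

end

section \<open>From pointwise bounds to suprema\<close>

theorem proposition3p3:
  fixes smul :: "'k::real_normed_field \<Rightarrow> 'a::ab_group_add \<Rightarrow> 'a"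
    and N :: "'a \<Rightarrow> real" and \<kappa> \<eta> :: real
  assumes "quasi_banach_space smul N"
    and "\<not> locally_convex smul N"
    and "\<kappa> = modulus_of_concavity N"
    and "0 < \<eta>" and "\<eta> < 1"
  shows "\<exists>(F :: real \<Rightarrow> 'a) (r :: nat \<Rightarrow> real) (\<epsilon> :: nat \<Rightarrow> real).
           lipschitz_curve N F \<and> decreasing_to_zero r \<and> decreasing_to_zero \<epsilon> \<and>
           (\<forall>j s. (SUP t\<in>cball s (r j). N (F t - F s) / r j) \<le> \<eta> \<and>
                  (SUP t\<in>cball s (\<epsilon> j). N (F t - F s) / \<epsilon> j) \<ge> (1 - \<eta>) / (2 * \<kappa> ^ 3))"
proof -
  interpret quasi_banach_space smul N
    by fact
  obtain F r \<epsilon> where F: "lipschitz_curve N F"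
    and r: "decreasing_to_zero r" and \<epsilon>: "decreasing_to_zero \<epsilon>"
    and slow: "\<And>j s t. \<bar>t - s\<bar> \<le> r j \<Longrightarrow> N (F t - F s) \<le> \<eta> * r j"
    and fast: "\<And>j s. \<exists>t. \<bar>t - s\<bar> \<le> \<epsilon> j \<and> (1 - \<eta>) / (2 * \<kappa> ^ 3) * \<epsilon> j \<le> N (F t - F s)"
    using oscillating_curve_exists[OF assms(2,4,5)] unfolding assms(3) by blast
  obtain L where L: "\<And>s t. N (F t - F s) \<le> L * \<bar>t - s\<bar>"
    using F by (auto simp: lipschitz_curve_def)
  have "(SUP t\<in>cball s (r j). N (F t - F s) / r j) \<le> \<eta>" for j s
  proof -
    have "r j > 0"
      using r by (simp add: decreasing_to_zero_def)
    then show ?thesis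
      using slow by (intro cSUP_least) (auto simp: dist_real_def abs_minus_commute field_simps)
  qed
  moreover have "(SUP t\<in>cball s (\<epsilon> j). N (F t - F s) / \<epsilon> j) \<ge> (1 - \<eta>) / (2 * \<kappa> ^ 3)" for j s
  proof -
    have e: "\<epsilon> j > 0"
      using \<epsilon> by (simp add: decreasing_to_zero_def)
    obtain t where t: "\<bar>t - s\<bar> \<le> \<epsilon> j" "(1 - \<eta>) / (2 * \<kappa> ^ 3) * \<epsilon> j \<le> N (F t - F s)"
      using fast by blast
    \<comment> \<open>A real supremum dominates its members only on a bounded set; the Lipschitz
      constant provides the bound, and its absolute value avoids a discussion of its sign.\<close>
    have "N (F t - F s) / \<epsilon> j \<le> \<bar>L\<bar>" if "\<bar>t - s\<bar> \<le> \<epsilon> j" for t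
    proof -
      have "L * \<bar>t - s\<bar> \<le> \<bar>L\<bar> * \<epsilon> j"
        using that by (intro mult_mono) auto
      then show ?thesis
        using L[of t s] e by (simp add: field_simps)
    qed
    then have "bdd_above ((\<lambda>t. N (F t - F s) / \<epsilon> j) ` cball s (\<epsilon> j))"
      by (intro bdd_aboveI[of _ "\<bar>L\<bar>"]) (auto simp: dist_real_def abs_minus_commute)
    then show ?thesis
      by (rule cSUP_upper2[of _ _ t])
        (use t e in \<open>auto simp: dist_real_def abs_minus_commute pos_le_divide_eq\<close>)
  qed
  ultimately show ?thesis
    using F r \<epsilon> by blast
qed

end
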